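(* Let $n>1$ be an integer. Let $B_1$ be an open ball in $\mathbb{R}^n$ and let $S$ be a subset of $B_1$ that is closed for the induced topology on $B_1$ and homeomorphic to an open subset of $\mathbb{R}^{n-1}$. Let $B_2\subset B_1$ be an open ball that has nonempty intersection with exactly one connected component of $S$. Then for any connected component $C$ of $B_1\setminus S$ one of the following holds: (1) $C$ is disjoint from $B_2$; (2) $B_2\cap S\subset\overline{C}$; and exactly two connected components of $B_1\setminus S$ satisfy (2).
   Context: $\overline{C}$ denotes the topological closure of $C$. The balls $B_1$ and $B_2$ are not required to be concentric. *)

theory Defs
  imports "HOL-Analysis.Analysis"
begin

end

theory Submission
  imports Defs "HOL-Homology.Invariance_of_Domain"
begin

text \<open>
  The number of complementary components of a closed subset of \<open>\<real>\<^sup>n\<close> depends only on its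
  homeomorphism type. A component \<open>K\<close> of \<open>S\<close> is homeomorphic to a connected open set
  \<open>U \<subseteq> \<real>\<^sup>n\<^sup>-\<^sup>1\<close>, and \<open>U\<close> is also homeomorphic to the graph of \<open>1 / d\<close>, where \<open>d\<close> is the distance to
  the complement of \<open>U\<close>. This graph is closed in \<open>\<real>\<^sup>n\<close> and has exactly two complementary components,
  which merge as soon as a nonempty part of the graph is removed. So \<open>B1 - K\<close> has exactly two
  components, and both accumulate at every point of \<open>K\<close>. Finally, if two points of \<open>B2\<close> are separated
  by \<open>S\<close>, they are separated by a single component of \<open>S\<close>; this can only be the one that meets \<open>B2\<close>,
  because any other leaves the connected set \<open>B2\<close> inside its complement.
\<close>

section \<open>Counting components of complements of homeomorphic closed sets\<close>

lemma connected_components_of_top_of_set: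
  "connected_components_of (top_of_set S) = components S"
proof -
  have "connected_component_of_set (top_of_set S) x = connected_component_set S x" for x
    by (auto simp: connected_component_of_def connected_component_def connectedin_subtopology)
  then show ?thesis
    by (simp add: connected_components_of_def components_def)
qed

text \<open>\<open>P\<close> and \<open>Q\<close> may live in different types. Both are carried into
  the common space \<open>Euclidean_space n\<close>, where homeomorphic closed sets are known to
  have equally many complementary components.\<close>

lemma eqpoll_components_Euclidean_complements:
  fixes P :: "'a::topological_space set" and Q :: "'b::topological_space set"
  assumes P: "top_of_set P homeomorphic_space Euclidean_space n"
    and Q: "top_of_set Q homeomorphic_space Euclidean_space n"
    and A: "closedin (top_of_set P) A" and B: "closedin (top_of_set Q) B"
    and AB: "A homeomorphic B"
  shows "components (P - A) \<approx> components (Q - B)"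
proof -
  have *: "\<exists>A'. closedin (Euclidean_space n) A' \<and>
      top_of_set A homeomorphic_space subtopology (Euclidean_space n) A' \<and>
      components (P - A) \<approx> connected_components_of
        (subtopology (Euclidean_space n) (topspace (Euclidean_space n) - A'))"
    if P: "top_of_set P homeomorphic_space Euclidean_space n"
      and A: "closedin (top_of_set P) A" for P A :: "'c::topological_space set"
  proof -
    obtain f where f: "homeomorphic_map (top_of_set P) (Euclidean_space n) f"
      using P homeomorphic_space by blast
    have AP: "A \<subseteq> P"
      using A closedin_imp_subset by blast
    have fP: "f ` P = topspace (Euclidean_space n)" and inj: "inj_on f P"
      using f by (auto simp: homeomorphic_eq_everything_map)
    have sub: "homeomorphic_map (top_of_set T) (subtopology (Euclidean_space n) (f ` T)) f"
      if "T \<subseteq> P" for T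
    proof -
      have "homeomorphic_map (subtopology (top_of_set P) T) (subtopology (Euclidean_space n) (f ` T)) f"
        using that fP by (intro homeomorphic_map_subtopologies f) auto
      then show ?thesis
        using that by (simp add: subtopology_subtopology inf.absorb2)
    qed
    have "f ` (P - A) = topspace (Euclidean_space n) - f ` A"
      using fP inj AP by (metis inj_on_image_set_diff Diff_subset)
    then have h: "homeomorphic_map (top_of_set (P - A))
        (subtopology (Euclidean_space n) (topspace (Euclidean_space n) - f ` A)) f"
      using sub [of "P - A"] by auto
    have "components (P - A) \<approx> connected_components_of
        (subtopology (Euclidean_space n) (topspace (Euclidean_space n) - f ` A))"
    proof -
      have "inj_on (image f) (components (P - A))"
        using inj by (force intro: inj_on_subset [OF inj_on_image_Pow] dest: in_components_subset)
      then show ?thesis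
        by (metis h homeomorphic_map_connected_components_of connected_components_of_top_of_set
            inj_on_image_eqpoll_self eqpoll_sym)
    qed
    moreover have "closedin (Euclidean_space n) (f ` A)"
      using f A AP homeomorphic_map_closedness_eq by fastforce
    moreover have "top_of_set A homeomorphic_space subtopology (Euclidean_space n) (f ` A)"
      using sub [OF AP] homeomorphic_space by blast
    ultimately show ?thesis by blast
  qed
  obtain A' where A': "closedin (Euclidean_space n) A'"
    "top_of_set A homeomorphic_space subtopology (Euclidean_space n) A'"
    "components (P - A) \<approx> connected_components_of
        (subtopology (Euclidean_space n) (topspace (Euclidean_space n) - A'))"
    using * [OF P A] by blast
  obtain B' where B': "closedin (Euclidean_space n) B'"
    "top_of_set B homeomorphic_space subtopology (Euclidean_space n) B'"
    "components (Q - B) \<approx> connected_components_of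
        (subtopology (Euclidean_space n) (topspace (Euclidean_space n) - B'))"
    using * [OF Q B] by blast
  have "subtopology (Euclidean_space n) A' homeomorphic_space subtopology (Euclidean_space n) B'"
    using A'(2) B'(2) AB
    by (meson homeomorphic_space_iff_homeomorphic homeomorphic_space_sym homeomorphic_space_trans)
  then show ?thesis
    using eqpoll_connected_components_Euclidean_complements A' B' eqpoll_trans eqpoll_sym by meson
qed

section \<open>The model hypersurface and its complement\<close>

text \<open>The graph of \<open>1 / d\<close> over \<open>A\<close>. Written without division, it needs no care where \<open>d\<close> vanishes.\<close>

definition level_graph :: "('b \<Rightarrow> real) \<Rightarrow> 'b set \<Rightarrow> ('b \<times> real) set"
  where "level_graph d A = {(u, t). u \<in> A \<and> t * d u = 1}"

lemma open_eq_positive_set: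
  fixes U :: "'b::metric_space set"
  assumes "open U"
  obtains d :: "'b \<Rightarrow> real" where "continuous_on UNIV d" "\<And>u. d u \<ge> 0" "U = {u. d u > 0}"
proof (cases "U = UNIV")
  case True
  \<comment> \<open>\<open>setdist\<close> to the empty set is 0, so the distance to
    \<open>- U\<close> would fail here.\<close>
  then show ?thesis by (intro that [of "\<lambda>_. 1"]) auto
next
  case False
  show ?thesis
  proof
    show "continuous_on UNIV (\<lambda>u. setdist {u} (- U))"
      by (rule continuous_on_setdist)
    show "setdist {u} (- U) \<ge> 0" for u by (rule setdist_pos_le)
    have "closed (- U)" using assms by (rule closed_Compl)
    then have "setdist {u} (- U) = 0 \<longleftrightarrow> u \<in> - U" for u
      using False by (metis Compl_eq_Diff_UNIV Diff_eq_empty_iff UNIV_I setdist_eq_0_sing_1 closure_closed subsetI top.extremum_uniqueI)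
    then show "U = {u. setdist {u} (- U) > 0}"
      using setdist_pos_le by (auto simp: order_less_le) 
  qed
qed

text \<open>A connected subset of the union cannot meet both open pieces, so each piece is a maximal
  connected subset.\<close>

lemma card_components_disjoint_open_Un:
  fixes A B :: "'b::topological_space set"
  assumes "open A" "open B" "connected A" "connected B" "A \<noteq> {}" "B \<noteq> {}" "A \<inter> B = {}"
  shows "card (components (A \<union> B)) = 2"
proof -
  have *: "A \<in> components (A \<union> B)"
    if "open A" "open B" "connected A" "A \<noteq> {}" "A \<inter> B = {}" for A B :: "'b set"
    unfolding in_components_maximal
  proof (intro conjI allI impI)
    fix D
    assume D: "D \<noteq> {} \<and> A \<subseteq> D \<and> D \<subseteq> A \<union> B \<and> connected D"
    then have "A \<inter> D = {} \<or> B \<inter> D = {}"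
      using that by (intro connectedD) auto
    then show "D = A"
      using D that by blast
  qed (use that in auto)
  have "A \<in> components (A \<union> B)" "B \<in> components (A \<union> B)"
    using * [of A B] * [of B A] assms by (auto simp: Un_commute Int_commute)
  moreover have "D = A \<or> D = B" if D: "D \<in> components (A \<union> B)" for D
  proof -
    have "D \<inter> A \<noteq> {} \<or> D \<inter> B \<noteq> {}"
      using in_components_nonempty [OF D] in_components_subset [OF D] by blast
    then show ?thesis
      using components_eq [OF D] calculation by blast
  qed
  ultimately have "components (A \<union> B) = {A, B}"
    by blast
  moreover have "A \<noteq> B" using assms by blast
  ultimately show ?thesis by simp
qed

context
  fixes d :: "'b::euclidean_space \<Rightarrow> real" and U :: "'b set"
  assumes cont: "continuous_on UNIV d" and nonneg: "\<And>u. d u \<ge> 0" and U: "U = {u. d u > 0}"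
begin

text \<open>The equation \<open>t * d u = 1\<close> already forces \<open>u\<close> into
  \<open>U\<close>. Membership in \<open>U\<close> can thus be dropped, which leaves an intersection
  of two closed sets: the graph runs off to infinity near the boundary of \<open>U\<close>.\<close>

lemma closed_level_graph:
  assumes "closedin (top_of_set U) A"
  shows "closed (level_graph d A)"
proof -
  obtain A' where A': "closed A'" "A = U \<inter> A'"
    using assms unfolding closedin_closed by blast
  have "d u > 0" if "t * d u = 1" for t u
    using that nonneg [of u] by (cases "d u = 0") (auto simp: order_less_le)
  then have "level_graph d A = (A' \<times> UNIV) \<inter> {z. snd z * d (fst z) = 1}"
    unfolding level_graph_def A' U by auto
  moreover have "closed {z::'b \<times> real. snd z * d (fst z) = 1}"
    by (intro closed_Collect_eq continuous_intros continuous_on_compose2 [OF cont]) auto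
  ultimately show ?thesis
    using A' by (simp add: closed_Times closed_Int)
qed

lemma homeomorphic_level_graph:
  assumes "A \<subseteq> U"
  shows "A homeomorphic level_graph d A"
proof -
  have pos: "d u > 0" if "u \<in> A" for u
    using that assms U by auto
  have "homeomorphism A (level_graph d A) (\<lambda>u. (u, 1 / d u)) fst"
  proof
    show "continuous_on A (\<lambda>u. (u, 1 / d u))"
      using pos by (intro continuous_intros continuous_on_subset [OF cont]) force+
  qed (use pos in \<open>force simp: level_graph_def field_simps intro: continuous_intros\<close>)+
  then show ?thesis
    using homeomorphic_def by blast
qed

text \<open>Every vertical fibre of the region is an interval containing height 0, so all fibres are
  tied together by the horizontal hyperplane at that height.\<close>

lemma connected_below: "connected {(u, t). t * d u < 1}" (is "connected ?L")
proof -
  have "?L = (\<Union>u. {u} \<times> {t. t * d u < 1} \<union> UNIV \<times> {0})"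
    by auto
  moreover have "connected ({u} \<times> {t. t * d u < 1} \<union> (UNIV::'b set) \<times> {0})" for u
  proof (intro connected_Un connected_Times)
    have "(u, 0) \<in> {u} \<times> {t. t * d u < 1} \<inter> (UNIV::'b set) \<times> {0}"
      by simp
    then show "{u} \<times> {t. t * d u < 1} \<inter> (UNIV::'b set) \<times> {0} \<noteq> {}"
      by blast
    have "is_interval {t. t * d u < 1}"
      unfolding is_interval_1 using nonneg [of u]
      by (metis (mono_tags, lifting) mem_Collect_eq mult_right_mono order_le_less_trans)
    then show "connected {t. t * d u < 1}"
      by (simp add: is_interval_connected)
  qed auto
  moreover have "(undefined, 0) \<in> (\<Inter>u. {u} \<times> {t. t * d u < 1} \<union> (UNIV::'b set) \<times> {0})"
    by simp
  ultimately show ?thesis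
    using connected_Union [of "range (\<lambda>u. {u} \<times> {t. t * d u < 1} \<union> (UNIV::'b set) \<times> {0})"]
    by (metis (no_types, lifting) empty_iff rangeE)
qed

text \<open>Here \<open>d u\<close> is positive, so rescaling each fibre by \<open>d u\<close> turns
  the region into the product of \<open>U\<close> with a half-line.\<close>

lemma connected_above:
  assumes "connected U"
  shows "connected {(u, t). t * d u > 1}" (is "connected ?L")
proof -
  have pos: "d u > 0" if "t * d u > 1" for t u
    using that nonneg [of u] by (cases "d u = 0") (auto simp: order_less_le)
  have "?L = (\<lambda>(u, s). (u, s / d u)) ` (U \<times> {1<..})" (is "_ = ?R")
  proof
    show "?L \<subseteq> ?R"
    proof clarify
      fix u t assume "1 < t * d u"
      with pos [OF this] show "(u, t) \<in> ?R"
        by (intro image_eqI [of _ _ "(u, t * d u)"]) (auto simp: U)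
    qed
  qed (auto simp: U)
  moreover have "connected \<dots>"
  proof (rule connected_continuous_image)
    show "continuous_on (U \<times> {1<..}) (\<lambda>(u, s). (u, s / d u))"
      unfolding case_prod_unfold
      by (intro continuous_intros continuous_on_compose2 [OF cont]) (auto simp: U)
  qed (simp add: assms connected_Times)
  ultimately show ?thesis by simp
qed

lemma card_components_Compl_level_graph:
  assumes "connected U" "U \<noteq> {}"
  shows "card (components (- level_graph d U)) = 2"
proof -
  let ?L = "{(u, t). t * d u < 1}" and ?G = "{(u, t). t * d u > 1}"
  have "u \<in> U" if "t * d u = 1" for t u
    using that nonneg [of u] by (cases "d u = 0") (auto simp: U order_less_le)
  then have "- level_graph d U = ?L \<union> ?G"
    by (auto simp: level_graph_def)
  moreover have op: "open ?L" "open ?G"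
    unfolding case_prod_unfold
    by (intro open_Collect_less continuous_intros continuous_on_compose2 [OF cont]; auto)+
  obtain u where "u \<in> U" using assms by auto
  then have "(u, 0) \<in> ?L" "(u, 2 / d u) \<in> ?G" by (auto simp: U)
  then have "?L \<noteq> {}" "?G \<noteq> {}" by blast+
  moreover have "?L \<inter> ?G = {}" by auto
  ultimately show ?thesis
    using card_components_disjoint_open_Un [OF op] connected_below connected_above [OF assms(1)]
    by metis
qed

text \<open>Over a point \<open>q\<close> of \<open>Q\<close> the whole vertical line is free, and
  it joins the region below the graph to the region above it.\<close>

lemma connected_Compl_level_graph:
  assumes "connected U" "Q \<subseteq> U" "Q \<noteq> {}"
  shows "connected (- level_graph d (U - Q))"
proof -
  let ?L = "{(u, t). t * d u < 1}" and ?G = "{(u, t). t * d u > 1}"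
  have "connected (?L \<union> {q} \<times> UNIV \<union> ?G)" if "q \<in> Q" for q
  proof (intro connected_Un connected_below connected_above assms connected_Times)
    have "d q > 0"
      using that assms U by blast
    then have "(q, 0) \<in> ?L \<inter> {q} \<times> UNIV" "(q, 2 / d q) \<in> (?L \<union> {q} \<times> UNIV) \<inter> ?G"
      by simp_all
    then show "?L \<inter> {q} \<times> UNIV \<noteq> {}" "(?L \<union> {q} \<times> UNIV) \<inter> ?G \<noteq> {}"
      by blast+
  qed auto
  moreover obtain q where "q \<in> Q" using assms by blast
  then have "(q, 0) \<in> (\<Inter>q\<in>Q. ?L \<union> {q} \<times> UNIV \<union> ?G)"
    by simp
  ultimately have "connected (\<Union>q\<in>Q. ?L \<union> {q} \<times> UNIV \<union> ?G)"
    using connected_Union [of "(\<lambda>q. ?L \<union> {q} \<times> UNIV \<union> ?G) ` Q"]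
    by (metis (no_types, lifting) empty_iff imageE)
  moreover have "- level_graph d (U - Q) = (\<Union>q\<in>Q. ?L \<union> {q} \<times> UNIV \<union> ?G)"
  proof -
    have "u \<in> U" if "1 < t * d u \<or> t * d u = 1" for t u
      using that nonneg [of u] by (cases "d u = 0") (auto simp: U order_less_le)
    then have 1: "(u, t) \<in> - level_graph d (U - Q) \<longleftrightarrow> u \<in> Q \<or> t * d u < 1 \<or> 1 < t * d u" for u t
      using neq_iff [of "t * d u" 1] by (auto simp: level_graph_def)
    have 2: "(u, t) \<in> (\<Union>q\<in>Q. ?L \<union> {q} \<times> UNIV \<union> ?G) \<longleftrightarrow> u \<in> Q \<or> t * d u < 1 \<or> 1 < t * d u" for u t
      using \<open>q \<in> Q\<close> by blast
    show ?thesis by (rule Set.set_eqI) (metis 1 2 surj_pair)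
  qed
  ultimately show ?thesis by simp
qed

end

section \<open>Hypersurfaces in a homeomorphic copy of Euclidean space\<close>

lemma homeomorphic_UNIV_imp_Euclidean_space:
  fixes P :: "'a::euclidean_space set"
  assumes "P homeomorphic (UNIV :: 'a set)"
  shows "top_of_set P homeomorphic_space Euclidean_space DIM('a)"
proof -
  have "Euclidean_space DIM('a) homeomorphic_space (euclidean :: 'a topology)"
    using homeomorphic_maps_Euclidean_space_euclidean homeomorphic_space_def by metis
  moreover have "top_of_set P homeomorphic_space (euclidean :: 'a topology)"
    using assms homeomorphic_space_iff_homeomorphic [of P "UNIV :: 'a set"] by simp
  ultimately show ?thesis
    by (meson homeomorphic_space_sym homeomorphic_space_trans)
qed

context
  fixes P K :: "'a::euclidean_space set" and U :: "'b::euclidean_space set"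
  assumes P: "P homeomorphic (UNIV :: 'a set)" and DIM: "DIM('a) = DIM('b) + 1"
    and K: "closedin (top_of_set P) K" and KU: "K homeomorphic U"
    and U: "open U" "connected U" "U \<noteq> {}"
begin

text \<open>By \<open>DIM\<close>, the space \<open>'b \<times> real\<close> has the dimension of
  \<open>P\<close>, so complements in \<open>P\<close> can be studied on level graphs there.\<close>

lemma components_complement_eqpoll:
  fixes A :: "'a set" and B :: "('b \<times> real) set"
  assumes "closedin (top_of_set P) A" "closed B" "A homeomorphic B"
  shows "components (P - A) \<approx> components (- B)"
proof -
  have "top_of_set (UNIV :: ('b \<times> real) set) homeomorphic_space Euclidean_space DIM('a)"
    using homeomorphic_UNIV_imp_Euclidean_space [OF homeomorphic_refl, where ?'a = "'b \<times> real"] DIM by simp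
  from eqpoll_components_Euclidean_complements
    [OF homeomorphic_UNIV_imp_Euclidean_space [OF P] this assms(1) _ assms(3)]
  show ?thesis
    using assms(2) by (simp add: Compl_eq_Diff_UNIV)
qed

lemma card_components_hypersurface_complement: "card (components (P - K)) = 2"
proof -
  obtain d :: "'b \<Rightarrow> real" where d: "continuous_on UNIV d" "\<And>u. d u \<ge> 0" "U = {u. d u > 0}"
    using open_eq_positive_set [OF U(1)] by metis
  have "components (P - K) \<approx> components (- level_graph d U)"
    using closed_level_graph [OF d closedin_subtopology_refl [THEN iffD2]]
      homeomorphic_level_graph [OF d subset_refl] KU
    by (intro components_complement_eqpoll K) (auto intro: homeomorphic_trans)
  moreover have card: "card (components (- level_graph d U)) = 2"
    by (rule card_components_Compl_level_graph [OF d U(2,3)])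
  ultimately show ?thesis
    \<comment> \<open>An infinite set has \<open>card\<close> 0, so the value 2 also gives the
      finiteness needed to compare cardinalities.\<close>
    using eqpoll_iff_card by (metis card.infinite eqpoll_finite_iff zero_neq_numeral)
qed

text \<open>As \<open>V\<close> is open in \<open>K\<close>, the rest \<open>K - V\<close> is closed
  in \<open>P\<close> and corresponds to a level graph with a hole, whose complement is
  connected.\<close>

lemma connected_punctured_hypersurface_complement:
  assumes "V \<subseteq> K" "V \<noteq> {}" "openin (top_of_set K) V"
  shows "connected (P - (K - V))"
proof -
  obtain d :: "'b \<Rightarrow> real" where d: "continuous_on UNIV d" "\<And>u. d u \<ge> 0" "U = {u. d u > 0}"
    using open_eq_positive_set [OF U(1)] by metis
  obtain f g where fg: "homeomorphism K U f g"
    using KU homeomorphic_def by blast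
  have fK: "f ` K = U"
    by (rule homeomorphism_image1 [OF fg])
  have inj: "inj_on f K"
    by (rule inj_on_inverseI [of _ g]) (rule homeomorphism_apply1 [OF fg])
  have V: "closedin (top_of_set K) (K - V)"
    using assms(1,3) by (simp add: closedin_def double_diff)
  have img: "f ` (K - V) = U - f ` V"
    using inj_on_image_set_diff [OF inj Diff_subset assms(1)] fK by simp
  have "closedin (top_of_set U) (U - f ` V)"
    using homeomorphism_imp_closed_map [OF fg V] img by simp
  then have "closed (level_graph d (U - f ` V))"
    by (rule closed_level_graph [OF d])
  moreover have "K - V homeomorphic level_graph d (U - f ` V)"
  proof -
    have "K - V homeomorphic U - f ` V"
      unfolding homeomorphic_def
      using homeomorphism_of_subsets [OF fg Diff_subset _ img] by (metis Diff_subset)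
    then show ?thesis
      using homeomorphic_level_graph [OF d Diff_subset] homeomorphic_trans by blast
  qed
  ultimately have "components (P - (K - V)) \<approx> components (- level_graph d (U - f ` V))"
    using closedin_trans [OF V K] by (intro components_complement_eqpoll)
  moreover have "connected (- level_graph d (U - f ` V))"
    using assms fK by (intro connected_Compl_level_graph [OF d U(2)]) auto
  \<comment> \<open>Connectedness means having at most one component, which equipollence
    preserves.\<close>
  ultimately show ?thesis
    by (metis connected_eq_components_subset_sing_exists subset_singleton_iff_lepoll
        eqpoll_imp_lepoll lepoll_trans)
qed

text \<open>If \<open>C\<close> did not accumulate on a part \<open>V\<close> of \<open>K\<close>, it would stay clopen after adding \<open>V\<close> to the complement.\<close>

lemma hypersurface_subset_closure_component:
  assumes C: "C \<in> components (P - K)" and "open P"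
  shows "K \<subseteq> closure C"
proof (rule ccontr)
  assume "\<not> K \<subseteq> closure C"
  define V where "V = K - closure C"
  let ?W = "P - (K - V)"
  have V: "V \<subseteq> K" "V \<noteq> {}"
    using \<open>\<not> K \<subseteq> closure C\<close> by (auto simp: V_def)
  have "V = K \<inter> - closure C"
    by (auto simp: V_def)
  then have "openin (top_of_set K) V"
    by (metis openin_open_Int open_Compl closed_closure)
  then have W: "connected ?W"
    using connected_punctured_hypersurface_complement V by blast
  have CW: "C \<subseteq> ?W"
    using in_components_subset [OF C] by blast
  have "open (P - K)"
    using K \<open>open P\<close> by (metis openin_diff openin_open_eq openin_subtopology_self)
  then have "open C"
    using C open_components by blast
  then have "openin (top_of_set ?W) C"
    using CW by (metis open_subset)
  moreover have "closedin (top_of_set ?W) C"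
  proof -
    \<comment> \<open>Taking the closure of \<open>C\<close> adds nothing within \<open>?W\<close>:
      the restored points \<open>V\<close> avoid it by definition, and \<open>C\<close> is closed in
      \<open>P - K\<close>.\<close>
    have "?W \<inter> closure C = (P - K) \<inter> closure C"
      by (auto simp: V_def)
    also have "\<dots> = C"
    proof -
      obtain T where "closed T" "C = (P - K) \<inter> T"
        using closedin_component [OF C] unfolding closedin_closed by blast
      then show ?thesis
        using closure_minimal [of C T] closure_subset [of C] by blast
    qed
    finally show ?thesis
      by (metis closedin_closed_Int closed_closure)
  qed
  ultimately have "C = {} \<or> C = ?W"
    using W connected_clopen by blast
  \<comment> \<open>The nonempty set \<open>V\<close> lies in \<open>?W\<close> but misses
    \<open>C\<close>, which rules out \<open>C = ?W\<close>.\<close>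
  moreover have "V \<subseteq> ?W"
    using V K closedin_imp_subset by blast
  moreover have "V \<inter> C = {}"
    using V in_components_subset [OF C] by blast
  ultimately show False
    using V in_components_nonempty [OF C] by blast
qed

end

section \<open>Separation of two points by a single component\<close>

text \<open>The known theorem concerns closed subsets of the whole space. A homeomorphism of
  \<open>P\<close> onto that space makes \<open>S\<close> closed there, and connected sets joining
  \<open>a\<close> and \<open>b\<close> are carried back and forth.\<close>

lemma separation_by_component_closedin_pointwise:
  fixes P :: "'a::euclidean_space set"
  assumes P: "P homeomorphic (UNIV :: 'a set)" and S: "closedin (top_of_set P) S"
    and ab: "a \<in> P" "b \<in> P" "\<not> connected_component (P - S) a b"
  obtains K where "K \<in> components S" "\<not> connected_component (P - K) a b"
proof -
  obtain f g where fg: "homeomorphism P (UNIV :: 'a set) f g"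
    using P homeomorphic_def by blast
  then have gf: "\<And>x. x \<in> P \<Longrightarrow> g (f x) = x" and f_g: "\<And>y. f (g y) = y" and gP: "\<And>y. g y \<in> P"
    and cont: "continuous_on P f" "continuous_on UNIV g"
    by (auto simp: homeomorphism_def)
  have SP: "S \<subseteq> P"
    using S closedin_imp_subset by blast
  have "closed (f ` S)"
    using homeomorphism_imp_closed_map [OF fg S] by simp
  moreover have "\<not> connected_component (- f ` S) (f a) (f b)"
  proof
    assume "connected_component (- f ` S) (f a) (f b)"
    then obtain T where T: "connected T" "T \<subseteq> - f ` S" "f a \<in> T" "f b \<in> T"
      by (auto simp: connected_component_def)
    have "connected (g ` T)"
      using connected_continuous_image [OF continuous_on_subset [OF cont(2) subset_UNIV] T(1)] .
    moreover have "g ` T \<subseteq> P - S"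
    proof clarify
      fix y assume "y \<in> T"
      then have "f (g y) \<notin> f ` S"
        using T f_g by auto
      then show "g y \<in> P - S"
        using gP by blast
    qed
    moreover have "a \<in> g ` T" "b \<in> g ` T"
      using T gf ab by (metis imageI)+
    ultimately show False
      using ab by (auto simp: connected_component_def)
  qed
  ultimately obtain C where C: "C \<in> components (f ` S)" "\<not> connected_component (- C) (f a) (f b)"
    using separation_by_component_closed_pointwise by metis
  have "homeomorphic_map (top_of_set (f ` S)) (top_of_set S) g"
    unfolding homeomorphic_map_maps
    using homeomorphism_symD [OF homeomorphism_of_subsets [OF fg SP subset_UNIV refl]]
    by (metis homeomorphic_maps_iff_homeomorphism)
  then have "g ` C \<in> components S"
    using C homeomorphic_map_connected_components_of
    by (metis connected_components_of_top_of_set imageI)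
  moreover have "\<not> connected_component (P - g ` C) a b"
  proof
    assume "connected_component (P - g ` C) a b"
    then obtain T where T: "connected T" "T \<subseteq> P - g ` C" "a \<in> T" "b \<in> T"
      by (auto simp: connected_component_def)
    have "T \<subseteq> P"
      using T by blast
    then have "connected (f ` T)"
      using connected_continuous_image [OF continuous_on_subset [OF cont(1)] T(1)] by blast
    moreover have "f ` T \<subseteq> - C"
    proof clarify
      fix x assume "x \<in> T" "f x \<in> C"
      moreover have "g (f x) \<notin> g ` C"
        using gf T \<open>x \<in> T\<close> by auto
      ultimately show False
        by blast
    qed
    ultimately have "connected_component (- C) (f a) (f b)"
      using T(3,4) unfolding connected_component_def by (metis imageI)
    then show False
      using C by blast
  qed
  ultimately show ?thesis using that by blast
qed

section \<open>Local separation and the theorem for balls\<close>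

text \<open>Of the two balls only topological properties are kept. Inside \<open>B\<close> the sets
  \<open>S\<close> and \<open>K\<close> separate the same pairs of points, so each of the two sides
  of \<open>K\<close> yields one component of \<open>P - S\<close> that meets
  \<open>B\<close>.\<close>

lemma local_separation_by_hypersurface:
  fixes P S B :: "'a::euclidean_space set" and U :: "'b::euclidean_space set"
  assumes P: "open P" "P homeomorphic (UNIV :: 'a set)" and DIM: "DIM('a) = DIM('b) + 1"
    and S: "closedin (top_of_set P) S" and U: "open U" "S homeomorphic U"
    and B: "open B" "connected B" "B \<subseteq> P"
    and ex1: "\<exists>!K. K \<in> components S \<and> B \<inter> K \<noteq> {}"
  shows "(\<forall>C \<in> components (P - S). C \<inter> B = {} \<or> B \<inter> S \<subseteq> closure C) \<and>
         card {C \<in> components (P - S). B \<inter> S \<subseteq> closure C} = 2"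
proof -
  obtain K where K: "K \<in> components S" "B \<inter> K \<noteq> {}"
    and uniq: "\<And>K'. K' \<in> components S \<Longrightarrow> B \<inter> K' \<noteq> {} \<Longrightarrow> K' = K"
    using ex1 by blast
  have KS: "K \<subseteq> S"
    using K in_components_subset by blast
  have BS: "B \<inter> S = B \<inter> K"
  proof -
    have "x \<in> K" if "x \<in> B" "x \<in> S" for x
    proof -
      obtain K' where "K' \<in> components S" "x \<in> K'"
        using \<open>x \<in> S\<close> by (metis Union_components UnionE)
      then show ?thesis
        using uniq [of K'] \<open>x \<in> B\<close> by blast
    qed
    then show ?thesis
      using KS by blast
  qed
  have cloK: "closedin (top_of_set P) K"
    using closedin_trans [OF closedin_component [OF K(1)] S] .
  obtain f g where fg: "homeomorphism S U f g"
    using U homeomorphic_def by blast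
  have "homeomorphic_map (top_of_set S) (top_of_set U) f"
    unfolding homeomorphic_map_maps using fg by (metis homeomorphic_maps_iff_homeomorphism)
  then have fK: "f ` K \<in> components U"
    using K homeomorphic_map_connected_components_of
    by (metis connected_components_of_top_of_set imageI)
  have KU: "K homeomorphic f ` K"
    unfolding homeomorphic_def
    using homeomorphism_of_subsets [OF fg KS _ refl] in_components_subset [OF fK] by blast
  \<comment> \<open>Components of an open set are open, so \<open>K\<close> itself fits the
    hypersurface lemmas.\<close>
  have fK': "open (f ` K)" "connected (f ` K)" "f ` K \<noteq> {}"
    using fK U open_components in_components_connected in_components_nonempty by blast+
  obtain C1 C2 where C12: "components (P - K) = {C1, C2}" "C1 \<noteq> C2"
    using card_components_hypersurface_complement [OF P(2) DIM cloK KU fK'] card_2_iff by metis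
  have clo: "K \<subseteq> closure C" if "C \<in> components (P - K)" for C
    using hypersurface_subset_closure_component [OF P(2) DIM cloK KU fK' that P(1)] .
  have same: "connected_component (P - S) a b \<longleftrightarrow> connected_component (P - K) a b"
    if ab: "a \<in> B" "b \<in> B" for a b
  proof
    assume "connected_component (P - K) a b"
    show "connected_component (P - S) a b"
    proof (rule ccontr)
      assume sep: "\<not> connected_component (P - S) a b"
      obtain K' where K': "K' \<in> components S" "\<not> connected_component (P - K') a b"
        using separation_by_component_closedin_pointwise [OF P(2) S _ _ sep] B(3) ab
        by (metis subsetD)
      then have "K' \<noteq> K"
        using \<open>connected_component (P - K) a b\<close> by blast
      \<comment> \<open>Only \<open>K\<close> meets \<open>B\<close>; the connected set
        \<open>B\<close> then joins \<open>a\<close> to \<open>b\<close> outside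
        \<open>K'\<close>.\<close>
      then have "B \<subseteq> P - K'"
        using uniq K' B by blast
      then show False
        using K'(2) B(2) ab unfolding connected_component_def by blast
    qed
  qed (use KS in \<open>blast intro: connected_component_of_subset\<close>)
  \<comment> \<open>A side \<open>C\<close> of \<open>K\<close> may be cut further by other
    components of \<open>S\<close>, but never inside \<open>B\<close>: one piece \<open>D\<close>
    contains all of \<open>C \<inter> B\<close>.\<close>
  have side: "\<exists>D \<in> components (P - S). C \<inter> B \<subseteq> D \<and> B \<inter> S \<subseteq> closure D \<and> D \<subseteq> C"
    if C: "C \<in> components (P - K)" for C
  proof -
    have "B \<inter> closure C \<noteq> {}"
      using clo [OF C] K by blast
    then obtain a where a: "a \<in> B" "a \<in> C"
      using B open_Int_closure_eq_empty by blast
    have aP: "a \<in> P - S"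
      using a C BS B in_components_subset by blast
    have Ceq: "C = connected_component_set (P - K) a"
      using C a by (metis componentsE connected_component_eq)
    let ?D = "connected_component_set (P - S) a"
    have CB: "C \<inter> B \<subseteq> ?D"
      using same a Ceq by blast
    have "B \<inter> S \<subseteq> B \<inter> closure C"
      using BS clo [OF C] by blast
    \<comment> \<open>Since \<open>B\<close> is open, its points in the closure of \<open>C\<close>
      are approached from within \<open>B\<close>.\<close>
    also have "\<dots> \<subseteq> closure (B \<inter> C)"
      using B by (simp add: open_Int_closure_subset)
    also have "\<dots> \<subseteq> closure ?D"
      using CB by (intro closure_mono) blast
    finally have clD: "B \<inter> S \<subseteq> closure ?D" .
    have DC: "?D \<subseteq> C"
      unfolding Ceq using KS by (intro connected_component_mono) blast
    show ?thesis
      by (intro bexI [of _ ?D] conjI CB clD DC componentsI [OF aP])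
  qed
  have C: "C1 \<in> components (P - K)" "C2 \<in> components (P - K)"
    using C12(1) by simp_all
  have "\<Union> (components (P - K)) = P - K"
    by (metis Union_components)
  then have CC: "C1 \<union> C2 = P - K"
    unfolding C12(1) by simp
  obtain D1 where D1: "D1 \<in> components (P - S)" "C1 \<inter> B \<subseteq> D1" "B \<inter> S \<subseteq> closure D1" "D1 \<subseteq> C1"
    using side [OF C(1)] by (elim bexE conjE)
  obtain D2 where D2: "D2 \<in> components (P - S)" "C2 \<inter> B \<subseteq> D2" "B \<inter> S \<subseteq> closure D2" "D2 \<subseteq> C2"
    using side [OF C(2)] by (elim bexE conjE)
  have "C1 \<inter> C2 = {}"
    using C12(2) components_nonoverlap [OF C] by simp
  then have "D1 \<noteq> D2"
    using D1(4) D2(4) in_components_nonempty [OF D1(1)] by blast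
  have meets: "D \<in> {D1, D2}" if D: "D \<in> components (P - S)" "D \<inter> B \<noteq> {}" for D
  proof -
    obtain a where a: "a \<in> D" "a \<in> B"
      using D by blast
    then have "a \<in> P - K"
      using in_components_subset [OF D(1)] KS by blast
    then have "a \<in> C1 \<union> C2"
      using CC by blast
    then have "a \<in> D1 \<or> a \<in> D2"
      using D1(2) D2(2) a(2) by blast
    then show ?thesis
      using components_eq [OF D(1) D1(1)] components_eq [OF D(1) D2(1)] a(1) by blast
  qed
  \<comment> \<open>\<open>B \<inter> S\<close> is nonempty and \<open>B\<close> is open, so such a
    \<open>D\<close> enters \<open>B\<close> and \<open>meets\<close> leaves only \<open>D1\<close>
    and \<open>D2\<close>.\<close>
  have "D \<inter> B \<noteq> {}" if "B \<inter> S \<subseteq> closure D" for D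
    using that K(2) BS open_Int_closure_eq_empty [OF B(1), of D] by blast
  then have "{C \<in> components (P - S). B \<inter> S \<subseteq> closure C} = {D1, D2}"
    using meets D1(1,3) D2(1,3) by blast
  moreover have "\<forall>C \<in> components (P - S). C \<inter> B = {} \<or> B \<inter> S \<subseteq> closure C"
    using meets D1(3) D2(3) by blast
  ultimately show ?thesis
    using \<open>D1 \<noteq> D2\<close> by simp
qed

theorem theorem5:
  fixes n :: nat
    and B1 B2 S :: "(real ^ 'n) set"
    and c1 c2 :: "real ^ 'n" and r1 r2 :: real
    and U :: "(real ^ 'm) set"
  assumes "n > 1" and "CARD('n) = n" and "CARD('m) = n - 1"
    and "r1 > 0" and "B1 = ball c1 r1"
    and "S \<subseteq> B1" and "closedin (top_of_set B1) S"
    and "open U" and "S homeomorphic U"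
    and "r2 > 0" and "B2 = ball c2 r2" and "B2 \<subseteq> B1"
    and "\<exists>!K. K \<in> components S \<and> B2 \<inter> K \<noteq> {}"
  shows "(\<forall>C \<in> components (B1 - S). C \<inter> B2 = {} \<or> B2 \<inter> S \<subseteq> closure C) \<and>
         card {C \<in> components (B1 - S). B2 \<inter> S \<subseteq> closure C} = 2"
proof (rule local_separation_by_hypersurface)
  show "B1 homeomorphic (UNIV :: (real ^ 'n) set)"
    using assms homeomorphic_ball_UNIV by blast
  \<comment> \<open>The subtraction in \<open>CARD('m) = n - 1\<close> is on naturals and is exact
    because \<open>n > 1\<close>.\<close>
  show "DIM(real ^ 'n) = DIM(real ^ 'm) + 1"
    using assms by simp
qed (use assms in auto)

end
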